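(* Let $I=[x_0,x_N]$ be a compact interval with partition $\Delta: x_0<x_1<\dots<x_N$, $N\ge 2$, and let $\alpha=(\alpha_1,\dots,\alpha_N)$ be a scale vector, i.e. $|\alpha_i|<1$ for all $i$. Let $f^\alpha$ be the $\alpha$-fractal function of $f\in\mathcal C(I)$ with base function $b\in\mathcal C(I)$ (so $b(x_0)=f(x_0)$, $b(x_N)=f(x_N)$) and partition $\Delta$. Then $$\int_{x_0}^{x_N} f^\alpha(x)\,dx=\frac{1}{1-\lambda}\int_{x_0}^{x_N} f(x)\,dx-\frac{\lambda}{1-\lambda}\int_{x_0}^{x_N} b(x)\,dx,$$ where $\lambda=\sum_{i=1}^N a_i\alpha_i$ and $a_i=\frac{x_i-x_{i-1}}{x_N-x_0}$.
   Context: $\mathcal C(I)$ is the space of continuous real-valued functions on $I$. Let $N\ge2$, let $\Delta:x_0<x_1<\dots<x_N$ be a partition of $I=[x_0,x_N]$, and set $I_i=[x_{i-1},x_i]$ for $i=1,\dots,N$. Let $L_i:I\to I_i$, $L_i(x)=a_ix+e_i$, with $a_i=\frac{x_i-x_{i-1}}{x_N-x_0}$ and $e_i=\frac{x_Nx_{i-1}-x_0x_i}{x_N-x_0}$, so $L_i(x_0)=x_{i-1}$ and $L_i(x_N)=x_i$. A scale vector is $\alpha=(\alpha_1,\dots,\alpha_N)\in\mathbb R^N$ with $|\alpha_i|<1$ for all $i$. A base function for $f\in\mathcal C(I)$ is a function $b\in\mathcal C(I)$ with $b(x_0)=f(x_0)$ and $b(x_N)=f(x_N)$. The $\alpha$-fractal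 function $f^\alpha$ of $f$ with base function $b$ and partition $\Delta$ is the continuous function on $I$ whose graph is the attractor of the iterated function system $W_i(x,y)=(L_i(x),\ \alpha_i y+f(L_i(x))-\alpha_i b(x))$, $i=1,\dots,N$, on $I\times\mathbb R$; equivalently, it is the unique function in $\mathcal C(I)$ satisfying $f^\alpha(x)=f(x)+\alpha_i\,(f^\alpha-b)(L_i^{-1}(x))$ for all $x\in I_i$, $i=1,\dots,N$. *)

theory Defs
  imports "HOL-Analysis.Analysis"
begin

definition is_partition :: "nat \<Rightarrow> (nat \<Rightarrow> real) \<Rightarrow> bool" where
  "is_partition N x \<longleftrightarrow> (\<forall>i<N. x i < x (Suc i))"

text \<open>\<open>map_ratio\<close> and \<open>map_shift\<close> are the coefficients \<open>a\<^sub>i\<close> and \<open>e\<^sub>i\<close> of the affine map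
  \<open>L\<^sub>i\<close> of \<open>[x\<^sub>0, x\<^sub>N]\<close> onto \<open>[x\<^sub>i\<^sub>-\<^sub>1, x\<^sub>i]\<close>; they are only used for \<open>1 \<le> i \<le> N\<close>, where the
  subtraction \<open>i - 1\<close> on natural numbers does not truncate.\<close>

definition map_ratio :: "nat \<Rightarrow> (nat \<Rightarrow> real) \<Rightarrow> nat \<Rightarrow> real" where
  "map_ratio N x i = (x i - x (i - 1)) / (x N - x 0)"

definition map_shift :: "nat \<Rightarrow> (nat \<Rightarrow> real) \<Rightarrow> nat \<Rightarrow> real" where
  "map_shift N x i = (x N * x (i - 1) - x 0 * x i) / (x N - x 0)"

definition affine_map :: "nat \<Rightarrow> (nat \<Rightarrow> real) \<Rightarrow> nat \<Rightarrow> real \<Rightarrow> real" where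
  "affine_map N x i t = map_ratio N x i * t + map_shift N x i"

definition is_scale_vector :: "nat \<Rightarrow> (nat \<Rightarrow> real) \<Rightarrow> bool" where
  "is_scale_vector N \<alpha> \<longleftrightarrow> (\<forall>i\<in>{1..N}. \<bar>\<alpha> i\<bar> < 1)"

definition is_base_function ::
    "nat \<Rightarrow> (nat \<Rightarrow> real) \<Rightarrow> (real \<Rightarrow> real) \<Rightarrow> (real \<Rightarrow> real) \<Rightarrow> bool" where
  "is_base_function N x f b \<longleftrightarrow>
     continuous_on {x 0..x N} b \<and> b (x 0) = f (x 0) \<and> b (x N) = f (x N)"

definition fractal_ifs ::
    "nat \<Rightarrow> (nat \<Rightarrow> real) \<Rightarrow> (nat \<Rightarrow> real) \<Rightarrow> (real \<Rightarrow> real) \<Rightarrow> (real \<Rightarrow> real)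
      \<Rightarrow> nat \<Rightarrow> real \<times> real \<Rightarrow> real \<times> real" where
  "fractal_ifs N x \<alpha> f b i = (\<lambda>(t, y).
     (affine_map N x i t, \<alpha> i * y + f (affine_map N x i t) - \<alpha> i * b t))"

text \<open>The attractor of an iterated function system \<open>w\<^sub>i\<close> (\<open>i \<in> J\<close>) on \<open>X\<close> is the unique nonempty
  compact subset of \<open>X\<close> that is invariant under the Hutchinson operator.\<close>

definition is_ifs_invariant ::
    "'a::metric_space set \<Rightarrow> 'i set \<Rightarrow> ('i \<Rightarrow> 'a \<Rightarrow> 'a) \<Rightarrow> 'a set \<Rightarrow> bool" where
  "is_ifs_invariant X J w A \<longleftrightarrow> A \<noteq> {} \<and> compact A \<and> A \<subseteq> X \<and> A = (\<Union>i\<in>J. w i ` A)"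

definition is_ifs_attractor ::
    "'a::metric_space set \<Rightarrow> 'i set \<Rightarrow> ('i \<Rightarrow> 'a \<Rightarrow> 'a) \<Rightarrow> 'a set \<Rightarrow> bool" where
  "is_ifs_attractor X J w A \<longleftrightarrow>
     is_ifs_invariant X J w A \<and> (\<forall>B. is_ifs_invariant X J w B \<longrightarrow> B = A)"

text \<open>Functions on \<open>I = [x\<^sub>0, x\<^sub>N]\<close> are represented by functions on \<open>real\<close> whose values outside \<open>I\<close>
  are irrelevant, so the fractal function is a predicate on \<open>g\<close>, which determines \<open>g\<close> on \<open>I\<close>
  (existence, uniqueness on \<open>I\<close> and the equivalence with the functional equation are proved
  below).\<close>

definition is_fractal_function ::
    "nat \<Rightarrow> (nat \<Rightarrow> real) \<Rightarrow> (nat \<Rightarrow> real) \<Rightarrow> (real \<Rightarrow> real) \<Rightarrow> (real \<Rightarrow> real)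
      \<Rightarrow> (real \<Rightarrow> real) \<Rightarrow> bool" where
  "is_fractal_function N x \<alpha> f b g \<longleftrightarrow>
     continuous_on {x 0..x N} g \<and>
     is_ifs_attractor ({x 0..x N} \<times> UNIV) {1..N} (fractal_ifs N x \<alpha> f b)
       ((\<lambda>t. (t, g t)) ` {x 0..x N})"

lemma partition_less:
  assumes "is_partition N x" "i < j" "j \<le> N"
  shows "x i < x j"
  using assms(2,3)
proof (induction j)
  case (Suc j)
  then have "x j < x (Suc j)" using assms(1) by (auto simp: is_partition_def)
  then show ?case using Suc by (cases "i = j") auto
qed simp

lemma partition_le:
  assumes "is_partition N x" "i \<le> j" "j \<le> N"
  shows "x i \<le> x j"
  using partition_less[OF assms(1)] assms(2,3) by (cases "i = j") (force simp: less_le)+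

lemma partition_pred:
  assumes "is_partition N x" "j \<in> {1..N}"
  shows "x 0 \<le> x (j - 1)" "x j \<le> x N" "i < j \<Longrightarrow> x i \<le> x (j - 1)"
  using assms(2) by (auto intro!: partition_le[OF assms(1)])

lemma map_ratio_bounds:
  assumes "N \<ge> 2" "is_partition N x" "i \<in> {1..N}"
  shows "0 < map_ratio N x i" "map_ratio N x i < 1"
proof -
  have 1: "x (i - 1) < x i" "x 0 < x N"
    using assms by (auto intro!: partition_less[of N])
  show "0 < map_ratio N x i" using 1 by (simp add: map_ratio_def)
  have "x i - x (i - 1) < x N - x 0"
  proof (cases "i = 1")
    case True
    then show ?thesis using partition_less[OF assms(2), of 1 N] assms by auto
  next
    case False
    then have "0 < i - 1" "i - 1 \<le> N" "i \<le> N" using assms(3) by auto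
    then show ?thesis
      using partition_less[OF assms(2), of 0 "i - 1"] partition_le[OF assms(2), of i N]
      by linarith
  qed
  then show "map_ratio N x i < 1" using 1 by (simp add: map_ratio_def)
qed

lemma affine_map_alt:
  assumes "x 0 < x N"
  shows "affine_map N x i t = x (i - 1) + map_ratio N x i * (t - x 0)"
    and "affine_map N x i t = x i + map_ratio N x i * (t - x N)"
proof -
  have d: "x N - x 0 \<noteq> 0" using assms by simp
  have s: "map_shift N x i * (x N - x 0) = x N * x (i - 1) - x 0 * x i"
    and r: "map_ratio N x i * (x N - x 0) = x i - x (i - 1)"
    using d by (simp_all add: map_shift_def map_ratio_def)
  have "map_shift N x i = x (i - 1) - map_ratio N x i * x 0"
    by (rule mult_right_cancel[OF d, THEN iffD1]) (use r s in algebra)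
  then show "affine_map N x i t = x (i - 1) + map_ratio N x i * (t - x 0)"
    by (simp add: affine_map_def algebra_simps)
  have "map_shift N x i = x i - map_ratio N x i * x N"
    by (rule mult_right_cancel[OF d, THEN iffD1]) (use r s in algebra)
  then show "affine_map N x i t = x i + map_ratio N x i * (t - x N)"
    by (simp add: affine_map_def algebra_simps)
qed

lemma affine_map_mem:
  assumes "N \<ge> 2" "is_partition N x" "i \<in> {1..N}"
  shows "affine_map N x i t \<in> {x (i - 1)..x i} \<longleftrightarrow> t \<in> {x 0..x N}"
proof -
  have 0: "x 0 < x N" using assms by (auto intro!: partition_less)
  have "x (i - 1) \<le> affine_map N x i t \<longleftrightarrow> x 0 \<le> t"
    unfolding affine_map_alt(1)[OF 0] using map_ratio_bounds(1)[OF assms]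
    by (simp add: zero_le_mult_iff)
  moreover have "affine_map N x i t \<le> x i \<longleftrightarrow> t \<le> x N"
    unfolding affine_map_alt(2)[OF 0] using map_ratio_bounds(1)[OF assms]
    by (simp add: mult_le_0_iff)
  ultimately show ?thesis by simp
qed

lemma affine_map_inverse:
  assumes "N \<ge> 2" "is_partition N x" "i \<in> {1..N}"
  shows "affine_map N x i ((t - map_shift N x i) / map_ratio N x i) = t"
    and "(affine_map N x i t - map_shift N x i) / map_ratio N x i = t"
  using map_ratio_bounds(1)[OF assms] by (auto simp: affine_map_def)

lemma partition_cover:
  assumes "is_partition N x" "t \<in> {x 0..x N}" "N \<ge> 1"
  shows "\<exists>i\<in>{1..N}. t \<in> {x (i - 1)..x i}"
proof -
  define j where "j = (LEAST i. i \<ge> 1 \<and> t \<le> x i)"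
  have ex: "N \<ge> 1 \<and> t \<le> x N" using assms by auto
  have j: "j \<ge> 1 \<and> t \<le> x j" unfolding j_def by (rule LeastI[of _ N]) (use ex in auto)
  have jN: "j \<le> N" unfolding j_def by (rule Least_le) (use ex in auto)
  have "x (j - 1) \<le> t"
  proof (cases "j = 1")
    case True then show ?thesis using assms by auto
  next
    case False
    then have "j - 1 < j" "j - 1 \<ge> 1" using j by auto
    then show ?thesis using not_less_Least[of "j - 1" "\<lambda>i. i \<ge> 1 \<and> t \<le> x i"]
      by (auto simp: j_def)
  qed
  then show ?thesis using j jN by auto
qed

lemma graph_attractor_iff:
  fixes f b g :: "real \<Rightarrow> real"
  assumes N: "N \<ge> 2" and part: "is_partition N x" and scale: "is_scale_vector N \<alpha>"
    and f: "continuous_on {x 0..x N} f" and base: "is_base_function N x f b"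
  shows "is_fractal_function N x \<alpha> f b g \<longleftrightarrow>
    continuous_on {x 0..x N} g \<and>
    (\<forall>i\<in>{1..N}. \<forall>t\<in>{x 0..x N}.
       g (affine_map N x i t) = f (affine_map N x i t) + \<alpha> i * (g t - b t))"
    (is "?L \<longleftrightarrow> ?C \<and> ?E")
proof -
  let ?I = "{x 0..x N}"
  let ?G = "(\<lambda>t. (t, g t)) ` ?I"
  let ?W = "fractal_ifs N x \<alpha> f b"
  have x0N: "x 0 < x N" using N part by (auto intro!: partition_less)
  have mem: "affine_map N x i t \<in> ?I" if "i \<in> {1..N}" "t \<in> ?I" for i t
    using affine_map_mem[OF N part that(1), of t] that
      partition_pred(1,2)[OF part that(1)] by auto
  have "?E" if L: ?L
  proof (intro ballI)
    fix i t assume i: "i \<in> {1..N}" and t: "t \<in> ?I"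
    have "?G = (\<Union>i\<in>{1..N}. ?W i ` ?G)"
      using L by (simp only: is_fractal_function_def is_ifs_attractor_def is_ifs_invariant_def)
    then have "?W i (t, g t) \<in> ?G" using i t by blast
    then show "g (affine_map N x i t) = f (affine_map N x i t) + \<alpha> i * (g t - b t)"
      by (auto simp: fractal_ifs_def algebra_simps)
  qed
  moreover have ?L if C: ?C and E: ?E
  proof -
    have WG: "?W i (t, g t) = (affine_map N x i t, g (affine_map N x i t))"
      if "i \<in> {1..N}" "t \<in> ?I" for i t
      using E that by (simp add: fractal_ifs_def algebra_simps)
    have inv: "?G = (\<Union>i\<in>{1..N}. ?W i ` ?G)"
    proof (intro equalityI subsetI)
      fix p assume "p \<in> ?G"
      then obtain t where t: "t \<in> ?I" "p = (t, g t)" by auto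
      obtain i where i: "i \<in> {1..N}" "t \<in> {x (i - 1)..x i}"
        using partition_cover[OF part t(1)] N by auto
      define s where "s = (t - map_shift N x i) / map_ratio N x i"
      have s: "affine_map N x i s = t" using affine_map_inverse[OF N part i(1)] by (simp add: s_def)
      then have sI: "s \<in> ?I" using affine_map_mem[OF N part i(1), of s] i by auto
      have "p = ?W i (s, g s)" using WG[OF i(1) sI] s t by simp
      then show "p \<in> (\<Union>i\<in>{1..N}. ?W i ` ?G)" using i sI by blast
    next
      fix p assume "p \<in> (\<Union>i\<in>{1..N}. ?W i ` ?G)"
      then show "p \<in> ?G" using WG mem by auto
    qed
    have comp: "compact ?G"
      by (intro compact_continuous_image continuous_intros C) auto
    have "B = ?G" if B: "is_ifs_invariant (?I \<times> UNIV) {1..N} ?W B" for B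
    proof -
      have Bne: "B \<noteq> {}" and Bc: "compact B" and BX: "B \<subseteq> ?I \<times> UNIV"
        and Beq: "B = (\<Union>i\<in>{1..N}. ?W i ` B)"
        using B unfolding is_ifs_invariant_def by blast+
      have fstB: "fst ` B \<subseteq> ?I" using BX by auto
      have "continuous_on B (\<lambda>p. \<bar>snd p - g (fst p)\<bar>)"
        by (intro continuous_intros continuous_on_compose2[OF C]) (use fstB in auto)
      from continuous_attains_sup[OF Bc Bne this] obtain q where q: "q \<in> B"
        "\<And>p. p \<in> B \<Longrightarrow> \<bar>snd p - g (fst p)\<bar> \<le> \<bar>snd q - g (fst q)\<bar>" by auto
      obtain i p where ip: "i \<in> {1..N}" "p \<in> B" "q = ?W i p" using q(1) Beq by blast
      have pI: "fst p \<in> ?I" using ip fstB by auto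
      have "snd q - g (fst q) = \<alpha> i * (snd p - g (fst p))"
        using ip E pI by (auto simp: fractal_ifs_def case_prod_beta algebra_simps)
      then have "\<bar>snd q - g (fst q)\<bar> = \<bar>\<alpha> i\<bar> * \<bar>snd p - g (fst p)\<bar>" by (simp add: abs_mult)
      also have "\<dots> \<le> \<bar>\<alpha> i\<bar> * \<bar>snd q - g (fst q)\<bar>"
        by (intro mult_left_mono q ip) auto
      finally have le: "\<bar>snd q - g (fst q)\<bar> \<le> \<bar>\<alpha> i\<bar> * \<bar>snd q - g (fst q)\<bar>" .
      have "\<bar>\<alpha> i\<bar> < 1" using scale ip by (auto simp: is_scale_vector_def)
      then have q0: "\<bar>snd q - g (fst q)\<bar> = 0"
        using le mult_less_cancel_right2[of "\<bar>\<alpha> i\<bar>" "\<bar>snd q - g (fst q)\<bar>"] by linarith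
      have on: "snd p = g (fst p)" if "p \<in> B" for p using q(2)[OF that] q0 by auto
      let ?P = "fst ` B"
      have Pc: "compact ?P" by (intro compact_continuous_image continuous_intros Bc)
      have Pinv: "affine_map N x i s \<in> ?P" if "i \<in> {1..N}" "s \<in> ?P" for i s
      proof -
        obtain p where p: "p \<in> B" "s = fst p" using \<open>s \<in> ?P\<close> by (metis imageE)
        then have "?W i p \<in> B" using Beq that by blast
        moreover have "fst (?W i p) = affine_map N x i s"
          using p by (simp add: fractal_ifs_def case_prod_beta)
        ultimately show ?thesis by force
      qed
      have "?I \<noteq> {}" using x0N by auto
      moreover have "continuous_on ?I (\<lambda>t. infdist t ?P)" by (intro continuous_intros)
      ultimately have "\<exists>t\<in>?I. \<forall>s\<in>?I. infdist s ?P \<le> infdist t ?P"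
        by (intro continuous_attains_sup) auto
      then obtain t where t: "t \<in> ?I" "\<And>s. s \<in> ?I \<Longrightarrow> infdist s ?P \<le> infdist t ?P"
        by blast
      obtain i where i: "i \<in> {1..N}" "t \<in> {x (i - 1)..x i}"
        using partition_cover[OF part t(1)] N by auto
      define s where "s = (t - map_shift N x i) / map_ratio N x i"
      have s: "affine_map N x i s = t" using affine_map_inverse[OF N part i(1)] by (simp add: s_def)
      then have sI: "s \<in> ?I" using affine_map_mem[OF N part i(1), of s] i by auto
      obtain p where p: "p \<in> ?P" "infdist s ?P = dist s p"
        using infdist_attains_inf[of ?P s] Pc Bne compact_imp_closed by (metis image_is_empty)
      note r = map_ratio_bounds[OF N part i(1)]
      have "infdist t ?P \<le> dist t (affine_map N x i p)"
        by (intro infdist_le Pinv i p)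
      also have "\<dots> = map_ratio N x i * dist s p"
        using r s by (auto simp: affine_map_def dist_real_def right_diff_distrib[symmetric] abs_mult)
      also have "\<dots> \<le> map_ratio N x i * infdist t ?P"
        using t(2)[OF sI] p r by (intro mult_left_mono) auto
      finally have "infdist t ?P = 0"
        using r infdist_nonneg[of t ?P] mult_less_cancel_right2[of "map_ratio N x i" "infdist t ?P"]
        by linarith
      then have "infdist s ?P = 0" if "s \<in> ?I" for s
        using t(2)[OF that] infdist_nonneg[of s ?P] by linarith
      then have "?I \<subseteq> ?P"
        using in_closed_iff_infdist_zero[of ?P] Pc Bne by (auto simp: compact_imp_closed)
      then have P: "?P = ?I" using fstB by auto
      show "B = ?G"
      proof (intro equalityI subsetI)
        fix p assume "p \<in> B"
        then have "p = (fst p, g (fst p))" "fst p \<in> ?I" using on fstB by (auto simp: prod_eq_iff)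
        then show "p \<in> ?G" by blast
      next
        fix p assume "p \<in> ?G"
        then obtain t where tt: "t \<in> ?I" "p = (t, g t)" by auto
        then obtain p' where "p' \<in> B" "t = fst p'" using P by (metis imageE)
        then show "p \<in> B" using on tt by (metis prod.collapse)
      qed
    qed
    moreover have "is_ifs_invariant (?I \<times> UNIV) {1..N} ?W ?G"
      unfolding is_ifs_invariant_def using inv comp x0N by auto
    ultimately show ?L
      using C unfolding is_fractal_function_def is_ifs_attractor_def by blast
  qed
  ultimately show ?thesis unfolding is_fractal_function_def by blast
qed

lemma fractal_function_iff:
  assumes N: "N \<ge> 2" and part: "is_partition N x" and "is_scale_vector N \<alpha>"
    and "continuous_on {x 0..x N} f" and "is_base_function N x f b"
  shows "is_fractal_function N x \<alpha> f b g \<longleftrightarrow>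
    continuous_on {x 0..x N} g \<and>
    (\<forall>i\<in>{1..N}. \<forall>t\<in>{x (i - 1)..x i}.
       g t = f t + \<alpha> i * (g (the_inv (affine_map N x i) t) - b (the_inv (affine_map N x i) t)))"
proof -
  have inv: "the_inv (affine_map N x i) (affine_map N x i t) = t" if "i \<in> {1..N}" for i t
    using map_ratio_bounds(1)[OF N part that]
    by (intro the_inv_f_f injI) (auto simp: affine_map_def)
  have surj: "\<exists>s\<in>{x 0..x N}. t = affine_map N x i s"
    if "i \<in> {1..N}" "t \<in> {x (i - 1)..x i}" for i t
    using affine_map_inverse(1)[OF N part that(1), of t] affine_map_mem[OF N part that(1)] that(2)
    by metis
  have "(\<forall>t\<in>{x 0..x N}. g (affine_map N x i t) = f (affine_map N x i t) + \<alpha> i * (g t - b t)) \<longleftrightarrow>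
    (\<forall>t\<in>{x (i - 1)..x i}.
       g t = f t + \<alpha> i * (g (the_inv (affine_map N x i) t) - b (the_inv (affine_map N x i) t)))"
    if i: "i \<in> {1..N}" for i
    using inv[OF i] surj[OF i] affine_map_mem[OF N part i] by (metis (no_types, lifting))
  then show ?thesis unfolding graph_attractor_iff[OF assms] by auto
qed

lemma fractal_function_unique:
  assumes "x 0 \<le> x N" "is_fractal_function N x \<alpha> f b g" "is_fractal_function N x \<alpha> f b h"
    and "t \<in> {x 0..x N}"
  shows "g t = h t"
proof -
  have "(\<lambda>t. (t, g t)) ` {x 0..x N} = (\<lambda>t. (t, h t)) ` {x 0..x N}"
    using assms(2,3) unfolding is_fractal_function_def is_ifs_attractor_def by blast
  then show ?thesis using assms(4) by blast
qed

lemma partition_separate: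
  assumes "is_partition N x" "N \<ge> 1"
  shows "\<exists>j\<in>{1..N}. \<forall>i\<in>{1..N} - {j}. t \<le> x (i - 1) \<or> x i \<le> t"
proof -
  consider "t < x 0" | "t \<in> {x 0..x N}" | "t > x N" by fastforce
  then show ?thesis
  proof cases
    case 1
    have "t \<le> x (i - 1)" if "i \<in> {1..N}" for i
      using partition_pred(1)[OF assms(1) that] 1 by linarith
    then show ?thesis using assms(2) by (intro bexI[of _ 1]) auto
  next
    case 2
    then obtain j where j: "j \<in> {1..N}" "t \<in> {x (j - 1)..x j}"
      using partition_cover assms by blast
    have "t \<le> x (i - 1) \<or> x i \<le> t" if "i \<in> {1..N} - {j}" for i
    proof (cases "i < j")
      case True
      then show ?thesis using partition_pred(3)[OF assms(1) j(1) True] j(2) by auto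
    next
      case False
      then have "j < i" "i \<in> {1..N}" using that by auto
      then show ?thesis using partition_pred(3)[OF assms(1), of i j] j(2) by auto
    qed
    then show ?thesis using j by blast
  next
    case 3
    have "x i \<le> t" if "i \<in> {1..N}" for i
      using partition_le[OF assms(1), of i N] 3 that by auto
    then show ?thesis using assms(2) by (intro bexI[of _ 1]) auto
  qed
qed

lemma fractal_function_exists:
  fixes f b :: "real \<Rightarrow> real"
  assumes N: "N \<ge> 2" and part: "is_partition N x" and scale: "is_scale_vector N \<alpha>"
    and f: "continuous_on {x 0..x N} f" and base: "is_base_function N x f b"
  shows "\<exists>g. is_fractal_function N x \<alpha> f b g"
proof -
  let ?I = "{x 0..x N}"
  have x0N: "x 0 < x N" using N part by (auto intro!: partition_less)
  have b: "continuous_on ?I b" "b (x 0) = f (x 0)" "b (x N) = f (x N)"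
    using base by (auto simp: is_base_function_def)
  define cl where "cl t = max (x 0) (min (x N) t)" for t
  have cl: "cl t \<in> ?I" for t using x0N by (auto simp: cl_def)
  have cl_id: "cl t = t" if "t \<in> ?I" for t using that by (auto simp: cl_def)
  define r where "r i t = (t - map_shift N x i) / map_ratio N x i" for i t
  define D where "D h s = h (cl s) - b (cl s)" for h :: "real \<Rightarrow> real" and s
  define F where "F h t = f (cl t) + (\<Sum>i\<in>{1..N}. \<alpha> i *\<^sub>R D h (r i t))" for h t
  have bc: "(\<lambda>t. k (cl (q t))) \<in> bcontfun"
    if "continuous_on ?I k" "continuous_on UNIV q" for k q :: "real \<Rightarrow> real"
  proof -
    have "continuous_on UNIV (\<lambda>t. k (cl (q t)))"
      by (rule continuous_on_compose2[OF that(1)])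
        (use cl in \<open>auto simp: cl_def intro!: continuous_intros that(2)\<close>)
    moreover have "bounded (range (\<lambda>t. k (cl (q t))))"
      by (rule bounded_subset[OF compact_imp_bounded[OF compact_continuous_image[OF that(1)]]])
        (use cl in auto)
    ultimately show ?thesis by (simp add: bcontfun_def)
  qed
  have rc: "continuous_on UNIV (r i)" for i
    unfolding r_def divide_inverse by (intro continuous_intros)
  have Fb: "F h \<in> bcontfun" if h: "continuous_on ?I h" for h
  proof -
    have t: "(\<lambda>t. \<alpha> i *\<^sub>R D h (r i t)) \<in> bcontfun" for i
      unfolding D_def using bc[of "\<lambda>s. h s - b s" "r i"] h b rc
      by (intro scaleR_cont) (auto intro: continuous_intros)
    have "(\<lambda>t. \<Sum>i\<in>A. \<alpha> i *\<^sub>R D h (r i t)) \<in> bcontfun" if "finite A" for A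
      using that
    proof (induction A rule: finite_induct)
      case empty
      then show ?case by (simp add: const_bcontfun)
    next
      case (insert i A)
      then show ?case using plus_cont[OF t[of i] insert.IH] by simp
    qed
    then show ?thesis
      unfolding F_def using bc[OF f, of "\<lambda>t. t"] by (intro plus_cont) auto
  qed
  define T :: "(real \<Rightarrow>\<^sub>C real) \<Rightarrow> (real \<Rightarrow>\<^sub>C real)" where "T h = Bcontfun (F (apply_bcontfun h))" for h
  have T: "apply_bcontfun (T h) = F (apply_bcontfun h)" for h
    unfolding T_def by (rule Bcontfun_inverse[OF Fb]) auto
  define S where "S = {h :: real \<Rightarrow>\<^sub>C real. h (x 0) = f (x 0) \<and> h (x N) = f (x N)}"
  have Sclosed: "closed S"
  proof -
    have "S = PiC {x 0, x N} (\<lambda>t. {f t})"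
      by (auto simp: S_def mem_PiC_iff Pi_iff)
    then show ?thesis by (simp add: closed_PiC)
  qed
  have D0: "D h s = 0" if "h (x 0) = f (x 0)" "h (x N) = f (x N)" "s \<le> x 0 \<or> s \<ge> x N" for h s
  proof -
    have "cl s = x 0 \<or> cl s = x N" using that(3) x0N by (auto simp: cl_def)
    then show ?thesis using that b by (auto simp: D_def)
  qed
  have r_out: "r i t \<le> x 0 \<or> r i t \<ge> x N" if "i \<in> {1..N}" "t \<le> x (i - 1) \<or> x i \<le> t" for i t
  proof -
    have "t = affine_map N x i (r i t)" using affine_map_inverse[OF N part that(1)] by (simp add: r_def)
    then have "t = x (i - 1) + map_ratio N x i * (r i t - x 0)"
      "t = x i + map_ratio N x i * (r i t - x N)"
      using affine_map_alt[OF x0N, of i "r i t"] by auto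
    then have "map_ratio N x i * (r i t - x 0) \<le> 0 \<or> 0 \<le> map_ratio N x i * (r i t - x N)"
      using that(2) by linarith
    then show ?thesis using map_ratio_bounds(1)[OF N part that(1)]
      by (simp add: zero_le_mult_iff mult_le_0_iff)
  qed
  have F_single: "F h t = f (cl t) + \<alpha> j * D h (r j t)"
    if "h (x 0) = f (x 0)" "h (x N) = f (x N)" "j \<in> {1..N}"
      "\<forall>i\<in>{1..N} - {j}. t \<le> x (i - 1) \<or> x i \<le> t" for h t j
  proof -
    have "(\<Sum>i\<in>{1..N} - {j}. \<alpha> i *\<^sub>R D h (r i t)) = 0"
      using D0[OF that(1,2) r_out] that(4) by (intro sum.neutral) auto
    then show ?thesis using that(3) by (simp add: F_def sum.remove[of _ j])
  qed
  have F_piece: "F h (affine_map N x i t) = f (affine_map N x i t) + \<alpha> i * (h t - b t)"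
    if h: "h (x 0) = f (x 0)" "h (x N) = f (x N)" and i: "i \<in> {1..N}" and t: "t \<in> ?I" for h i t
  proof -
    have m: "affine_map N x i t \<in> {x (i - 1)..x i}" using affine_map_mem[OF N part i] t by auto
    have "affine_map N x i t \<le> x (k - 1) \<or> x k \<le> affine_map N x i t" if "k \<in> {1..N} - {i}" for k
    proof (cases "k < i")
      case True
      then show ?thesis using partition_pred(3)[OF part i True] m by auto
    next
      case False
      then have "i < k" "k \<in> {1..N}" using that by auto
      then show ?thesis using partition_pred(3)[OF part, of k i] m by auto
    qed
    then have "F h (affine_map N x i t)
        = f (cl (affine_map N x i t)) + \<alpha> i * D h (r i (affine_map N x i t))"
      by (intro F_single h i) auto
    moreover have "affine_map N x i t \<in> ?I"
      using m partition_pred(1,2)[OF part i] by auto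
    ultimately show ?thesis
      using t affine_map_inverse(2)[OF N part i, of t] by (simp add: cl_id D_def r_def)
  qed
  have TS: "T ` S \<subseteq> S"
  proof safe
    fix h assume h: "h \<in> S"
    then have h': "apply_bcontfun h (x 0) = f (x 0)" "apply_bcontfun h (x N) = f (x N)"
      by (auto simp: S_def)
    have "affine_map N x 1 (x 0) = x 0" "affine_map N x N (x N) = x N"
      using affine_map_alt(1)[OF x0N, of 1 "x 0"] affine_map_alt(2)[OF x0N, of N "x N"] by auto
    then show "T h \<in> S"
      using F_piece[OF h', of 1 "x 0"] F_piece[OF h', of N "x N"] N x0N h' b
      by (auto simp: S_def T)
  qed
  have "\<exists>c\<ge>0. c < 1 \<and> (\<forall>i\<in>{1..N}. \<bar>\<alpha> i\<bar> \<le> c)"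
  proof (intro exI conjI ballI)
    let ?c = "Max ((\<lambda>i. \<bar>\<alpha> i\<bar>) ` {1..N})"
    show "\<bar>\<alpha> i\<bar> \<le> ?c" if "i \<in> {1..N}" for i using that by auto
    then have "\<bar>\<alpha> 1\<bar> \<le> ?c" using N by (meson atLeastAtMost_iff le_trans one_le_numeral order_refl)
    then show "0 \<le> ?c" by linarith
    show "?c < 1" using scale N by (subst Max_less_iff) (auto simp: is_scale_vector_def)
  qed
  then obtain c where c: "c \<ge> 0" "c < 1" "\<And>i. i \<in> {1..N} \<Longrightarrow> \<bar>\<alpha> i\<bar> \<le> c" by blast
  have contr: "dist (T h) (T k) \<le> c * dist h k" if "h \<in> S" "k \<in> S" for h k
  proof (rule dist_bound)
    fix t
    obtain j where j: "j \<in> {1..N}" "\<forall>i\<in>{1..N} - {j}. t \<le> x (i - 1) \<or> x i \<le> t"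
      using partition_separate[OF part, of t] N by auto
    have "dist (T h t) (T k t) = \<bar>\<alpha> j * (D h (r j t) - D k (r j t))\<bar>"
      using F_single[OF _ _ j, of h] F_single[OF _ _ j, of k] that
      by (auto simp: T S_def dist_real_def algebra_simps)
    also have "\<dots> = \<bar>\<alpha> j\<bar> * dist (h (cl (r j t))) (k (cl (r j t)))"
      by (simp add: D_def abs_mult dist_real_def)
    also have "\<dots> \<le> c * dist h k"
      by (intro mult_mono c j dist_bounded) auto
    finally show "dist (T h t) (T k t) \<le> c * dist h k" .
  qed
  have "Bcontfun (\<lambda>t. b (cl t)) \<in> S"
    using bc[OF b(1), of "\<lambda>t. t"] b x0N by (simp add: S_def Bcontfun_inverse cl_id)
  then have "S \<noteq> {}" by auto
  then have "\<exists>!h. h \<in> S \<and> T h = h"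
    using Banach_fix[OF _ _ c(1,2) TS] contr Sclosed by (simp add: complete_eq_closed)
  then obtain h where h: "h \<in> S" "T h = h" by blast
  then have "F (apply_bcontfun h) = apply_bcontfun h" using T by metis
  then have "is_fractal_function N x \<alpha> f b (apply_bcontfun h)"
    unfolding graph_attractor_iff[OF assms]
    using F_piece[of "apply_bcontfun h"] h(1) by (auto simp: S_def)
  then show ?thesis by blast
qed

end

theory Submission
  imports Defs
begin

text \<open>Splitting \<open>\<integral> f\<^sup>\<alpha>\<close> over the subintervals and substituting \<open>L\<^sub>i\<close> in the \<open>i\<close>-th piece, the
  functional equation gives \<open>\<integral> f\<^sup>\<alpha> = \<integral> f + \<lambda> (\<integral> f\<^sup>\<alpha> - \<integral> b)\<close>. Since the \<open>a\<^sub>i\<close> are positive and sum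
  to \<open>1\<close>, \<open>\<lambda> < 1\<close> and the equation can be solved for \<open>\<integral> f\<^sup>\<alpha>\<close>.\<close>

text \<open>Change of variables along \<open>affine_map N x i\<close>, whose derivative is the
  constant \<open>map_ratio N x i\<close> and which carries the endpoints of
  \<open>{x 0..x N}\<close> to those of the \<open>i\<close>-th piece.\<close>

lemma integral_affine_piece:
  fixes h :: "real \<Rightarrow> real"
  assumes "N \<ge> 2" "is_partition N x" "i \<in> {1..N}" and h: "continuous_on {x 0..x N} h"
  shows "integral {x (i - 1)..x i} h
    = map_ratio N x i * integral {x 0..x N} (\<lambda>t. h (affine_map N x i t))"
proof -
  have x0N: "x 0 < x N" using assms by (auto intro!: partition_less)
  have le: "x (i - 1) \<le> x i" using assms by (intro partition_le[OF assms(2)]) auto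
  have ends: "affine_map N x i (x 0) = x (i - 1)" "affine_map N x i (x N) = x i"
    using affine_map_alt(1)[OF x0N, of i "x 0"] affine_map_alt(2)[OF x0N, of i "x N"] by simp_all
  have "continuous_on {x (i - 1)..x i} h"
    using partition_pred(1,2)[OF assms(2,3)] by (intro continuous_on_subset[OF h]) auto
  moreover have "affine_map N x i ` {x 0..x N} \<subseteq> {x (i - 1)..x i}"
    using affine_map_mem[OF assms(1-3)] by blast
  moreover have "(affine_map N x i has_field_derivative map_ratio N x i) (at t within {x 0..x N})"
    for t
    unfolding affine_map_def by (auto intro!: derivative_eq_intros)
  ultimately have "((\<lambda>t. map_ratio N x i *\<^sub>R h (affine_map N x i t)) has_integral
      integral {affine_map N x i (x 0)..affine_map N x i (x N)} h) {x 0..x N}"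
    using x0N le ends by (intro has_integral_substitution) auto
  then show ?thesis by (simp add: ends has_integral_iff)
qed

lemma integral_partition:
  fixes h :: "real \<Rightarrow> real"
  assumes "is_partition N x" and h: "h integrable_on {x 0..x N}"
  shows "integral {x 0..x N} h = (\<Sum>i=1..N. integral {x (i - 1)..x i} h)"
proof -
  \<comment> \<open>The induction is on the number of pieces with \<open>N\<close> fixed, so that
    integrability on each initial segment is inherited from the whole interval.\<close>
  have "integral {x 0..x n} h = (\<Sum>i=1..n. integral {x (i - 1)..x i} h)" if "n \<le> N" for n
    using that
  proof (induction n)
    case (Suc n)
    have le: "x 0 \<le> x n" "x n \<le> x (Suc n)" "x (Suc n) \<le> x N"
      using Suc.prems by (auto intro!: partition_le[OF assms(1)])
    then have "h integrable_on {x 0..x (Suc n)}"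
      by (intro integrable_on_subinterval[OF h]) auto
    then have "integral {x 0..x (Suc n)} h = integral {x 0..x n} h + integral {x n..x (Suc n)} h"
      by (rule Henstock_Kurzweil_Integration.integral_combine[OF le(1,2), symmetric])
    then show ?case using Suc by simp
  qed simp
  then show ?thesis by simp
qed

lemma integral_affine_pieces:
  fixes h :: "real \<Rightarrow> real"
  assumes "N \<ge> 2" "is_partition N x" "continuous_on {x 0..x N} h"
  shows "integral {x 0..x N} h
    = (\<Sum>i=1..N. map_ratio N x i * integral {x 0..x N} (\<lambda>t. h (affine_map N x i t)))"
  using integral_partition[OF assms(2) integrable_continuous_real[OF assms(3)]]
    integral_affine_piece[OF assms(1,2) _ assms(3)] by simp

text \<open>For the constant function 1 the decomposition above reads
  \<open>x N - x 0 = (\<Sum>i=1..N. map_ratio N x i) * (x N - x 0)\<close>, and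
  \<open>x N - x 0\<close> cancels.\<close>

lemma sum_map_ratio:
  assumes "N \<ge> 2" "is_partition N x"
  shows "(\<Sum>i=1..N. map_ratio N x i) = 1"
proof -
  have "x 0 < x N" using assms by (auto intro!: partition_less)
  then show ?thesis
    using integral_affine_pieces[OF assms, of "\<lambda>_. 1"] by (simp add: sum_distrib_right[symmetric])
qed

text \<open>This is a weighted mean of numbers below 1, with positive weights of total 1. It makes
  \<open>1 - lam\<close> nonzero in the final division.\<close>

lemma scale_mean_less_1:
  assumes "N \<ge> 2" "is_partition N x" "is_scale_vector N \<alpha>"
  shows "(\<Sum>i=1..N. map_ratio N x i * \<alpha> i) < 1"
proof -
  have "(\<Sum>i=1..N. map_ratio N x i * \<alpha> i) < (\<Sum>i=1..N. map_ratio N x i)"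
    using assms map_ratio_bounds(1)[OF assms(1,2)]
    by (intro sum_strict_mono) (auto simp: is_scale_vector_def abs_less_iff)
  then show ?thesis using sum_map_ratio[OF assms(1,2)] by simp
qed

theorem theorem3p1:
  fixes N :: nat and x \<alpha> :: "nat \<Rightarrow> real" and f b f\<alpha> :: "real \<Rightarrow> real" and lam :: real
  assumes "N \<ge> 2"
    and "is_partition N x"
    and "is_scale_vector N \<alpha>"
    and "continuous_on {x 0..x N} f"
    and "is_base_function N x f b"
    and "is_fractal_function N x \<alpha> f b f\<alpha>"
    and "lam = (\<Sum>i=1..N. map_ratio N x i * \<alpha> i)"
  shows "integral {x 0..x N} f\<alpha> =
    1 / (1 - lam) * integral {x 0..x N} f - lam / (1 - lam) * integral {x 0..x N} b"
proof -
  let ?I = "{x 0..x N}"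
  \<comment> \<open>The attractor is traded for the functional equation, already pulled back to the
    whole interval as the substitution requires.\<close>
  have g: "continuous_on ?I f\<alpha>"
    and eq: "\<And>i t. i \<in> {1..N} \<Longrightarrow> t \<in> ?I \<Longrightarrow>
      f\<alpha> (affine_map N x i t) = f (affine_map N x i t) + \<alpha> i * (f\<alpha> t - b t)"
    using assms(6) graph_attractor_iff[OF assms(1-5)] by blast+
  have "b integrable_on ?I" "f\<alpha> integrable_on ?I"
    using assms(5) g by (auto simp: is_base_function_def intro: integrable_continuous_real)
  note gb = integrable_diff[OF this(2,1)] integral_diff[OF this(2,1)]
  have piece: "integral ?I (\<lambda>t. f\<alpha> (affine_map N x i t) - f (affine_map N x i t))
    = \<alpha> i * (integral ?I f\<alpha> - integral ?I b)" if i: "i \<in> {1..N}" for i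
  proof -
    have "integral ?I (\<lambda>t. f\<alpha> (affine_map N x i t) - f (affine_map N x i t))
        = integral ?I (\<lambda>t. \<alpha> i * (f\<alpha> t - b t))"
      using eq[OF i] by (intro integral_cong) simp
    then show ?thesis by (simp add: gb(2))
  qed
  \<comment> \<open>Only the difference \<open>f\<alpha> - f\<close> is split into pieces: its
    pullback along the \<open>i\<close>-th map is \<open>\<alpha> i * (f\<alpha> t - b t)\<close>,
    so the integral of \<open>f\<close> stays whole.\<close>
  have "integral ?I f\<alpha> - integral ?I f = integral ?I (\<lambda>t. f\<alpha> t - f t)"
    using g assms(4) by (simp add: integral_diff integrable_continuous_real)
  also have "\<dots> = (\<Sum>i=1..N. map_ratio N x i * (\<alpha> i * (integral ?I f\<alpha> - integral ?I b)))"
    using integral_affine_pieces[OF assms(1,2) continuous_on_diff[OF g assms(4)]] piece by simp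
  also have "\<dots> = lam * (integral ?I f\<alpha> - integral ?I b)"
    by (simp add: assms(7) sum_distrib_right mult.assoc)
  finally have "(1 - lam) * integral ?I f\<alpha> = integral ?I f - lam * integral ?I b"
    by (simp add: algebra_simps)
  moreover have "1 - lam \<noteq> 0" using scale_mean_less_1[OF assms(1-3)] assms(7) by simp
  ultimately have "integral ?I f\<alpha> = (integral ?I f - lam * integral ?I b) / (1 - lam)"
    by (simp add: eq_divide_eq mult.commute)
  then show ?thesis by (simp add: diff_divide_distrib)
qed

end
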